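(* For any fixed integer $n \geq 1$ and all real numbers $r, r'$ with $r \geq 1$ and $r' \geq 2r+1$, one has $$P_n(r) \geq P_n(r').$$
   Context: For an integer $n \geq 1$ and a real number $r \neq 0$, define $$P_n(r) = \left( \frac{\frac{1}{n}\sum_{i=1}^{n} i^r}{\frac{1}{n+1}\sum_{i=1}^{n+1} i^r} \right)^{1/r}.$$ *)

theory Defs
  imports Complex_Main
begin

text \<open>
  Every base of \<open>powr\<close> below is positive for \<open>n \<ge> 1\<close>, so \<open>powr\<close> is the usual real power.
  Only the values for \<open>n \<ge> 1\<close> and \<open>r \<noteq> 0\<close> are meaningful.
\<close>

definition P :: "nat \<Rightarrow> real \<Rightarrow> real" where
  "P n r =
     (((1 / real n) * (\<Sum>i = 1..n. real i powr r)) /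
      ((1 / real (n + 1)) * (\<Sum>i = 1..n + 1. real i powr r))) powr (1 / r)"

end

theory Submission
  imports Defs "HOL-Analysis.Convex"
begin

text \<open>
  Let \<open>M k\<close> be the mean of \<open>i powr r\<close> over \<open>i \<le> k\<close>, \<open>a = r' / r\<close> and \<open>b k = k * M k powr a\<close>. The claim
  says that \<open>(\<Sum>i\<le>n. i powr r') / b n\<close> increases with \<open>n\<close>, which follows once the quotients of
  increments \<open>(b k - b (k - 1)) / k powr r'\<close> decrease. After scaling, one step of this is
  \<open>(k - 1) p powr a + (k + 1) q powr a \<le> k m powr a + k v powr a\<close>, where the two sides have the same
  number of terms and the same sum. For \<open>p \<le> v < q < m\<close> interpolating \<open>x powr a\<close> by a quadratic
  at \<open>v\<close>, \<open>q\<close>, \<open>m\<close> reduces every exponent \<open>a \<ge> 2\<close> to \<open>a = 2\<close>; for \<open>p \<ge> v\<close> convexity suffices.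
  The case \<open>a = 2\<close> is a lower bound on \<open>M k\<close>, obtained from the Levin--Stechkin
  inequality for power sums. With \<open>(1 + 1 / k) powr r = exp (2 r x)\<close> that inequality becomes
  the monotonicity of \<open>r coth (r x) - coth x\<close>.
\<close>

section \<open>Estimates for hyperbolic functions and the logarithm\<close>

lemma sinh_mult_ge:
  fixes r x :: real
  assumes "r \<ge> 1" "x \<ge> 0"
  shows "r * sinh x \<le> sinh (r * x)"
proof -
  have "(\<lambda>t. sinh (r * t) - r * sinh t) 0 \<le> (\<lambda>t. sinh (r * t) - r * sinh t) x"
  proof (rule DERIV_nonneg_imp_nondecreasing[OF assms(2)])
    fix t :: real assume t: "0 \<le> t" "t \<le> x"
    have "1 * t \<le> r * t" using assms t by (intro mult_right_mono) auto
    hence "cosh t \<le> cosh (r * t)" using t by (subst cosh_real_nonneg_le_iff) auto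
    hence "r * cosh (r * t) - r * cosh t \<ge> 0" using assms by auto
    moreover have "((\<lambda>t. sinh (r * t) - r * sinh t) has_real_derivative r * cosh (r * t) - r * cosh t) (at t)"
      by (auto intro!: derivative_eq_intros)
    ultimately show "\<exists>y. ((\<lambda>t. sinh (r * t) - r * sinh t) has_real_derivative y) (at t) \<and> 0 \<le> y" by blast
  qed
  thus ?thesis by simp
qed

text \<open>The derivative is \<open>1 / sinh t ^ 2 - r ^ 2 / sinh (r * t) ^ 2\<close>, which is
  nonnegative by \<open>sinh_mult_ge\<close>. This drives the induction step of
  \<open>power_sum_ge\<close>.\<close>

lemma coth_scaled_diff_mono:
  fixes r x y :: real
  assumes "r \<ge> 1" "0 < x" "x \<le> y"
  shows "r * (cosh (r * x) / sinh (r * x)) - cosh x / sinh x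
       \<le> r * (cosh (r * y) / sinh (r * y)) - cosh y / sinh y"
proof -
  let ?g = "\<lambda>t. r * (cosh (r * t) / sinh (r * t)) - cosh t / sinh t"
  have "?g x \<le> ?g y"
  proof (rule DERIV_nonneg_imp_nondecreasing[OF assms(3)])
    fix t :: real assume t: "x \<le> t" "t \<le> y"
    have tp: "t > 0" using t assms by auto
    have s: "sinh t > 0" "sinh (r * t) > 0" using tp assms by auto
    have le: "r * sinh t \<le> sinh (r * t)" using sinh_mult_ge[of r t] tp assms by auto
    have "(r * sinh t)\<^sup>2 \<le> (sinh (r * t))\<^sup>2"
      using le s assms by (intro power_mono) auto
    hence "1 / (sinh t)\<^sup>2 - r\<^sup>2 / (sinh (r * t))\<^sup>2 \<ge> 0"
      using s by (simp add: divide_simps power_mult_distrib)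
    moreover have "(?g has_real_derivative 
        r * ((r * sinh (r*t) * sinh (r*t) - cosh (r*t) * (r * cosh (r*t))) / (sinh (r*t) * sinh (r*t)))
        - (sinh t * sinh t - cosh t * cosh t) / (sinh t * sinh t)) (at t)"
      using s by (auto intro!: derivative_eq_intros simp: algebra_simps)
    moreover have "r * ((r * sinh (r*t) * sinh (r*t) - cosh (r*t) * (r * cosh (r*t))) / (sinh (r*t) * sinh (r*t)))
        - (sinh t * sinh t - cosh t * cosh t) / (sinh t * sinh t) = 1 / (sinh t)\<^sup>2 - r\<^sup>2 / (sinh (r * t))\<^sup>2"
    proof -
      have c: "sinh u * sinh u - cosh u * cosh u = -1" for u :: real
        using cosh_square_eq[of u] by (simp add: power2_eq_square)
      have "r * sinh (r*t) * sinh (r*t) - cosh (r*t) * (r * cosh (r*t)) = r * (sinh (r*t) * sinh (r*t) - cosh (r*t) * cosh (r*t))"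
        by (simp add: algebra_simps)
      thus ?thesis unfolding c by (simp add: power2_eq_square)
    qed
    ultimately show "\<exists>y. (?g has_real_derivative y) (at t) \<and> 0 \<le> y" by metis
  qed
  thus ?thesis .
qed

text \<open>Supplies the sign of the derivative in \<open>coth_ge_quadratic\<close>. The difference
  vanishes at 0 and has derivative \<open>(2 * cosh t - t * sinh t) / 3\<close>; since
  \<open>sinh t < cosh t\<close>, this is nonnegative up to \<open>t = 2\<close>.\<close>

lemma mult_cosh_third_le_sinh:
  fixes x :: real
  assumes "0 \<le> x" "x \<le> 2"
  shows "x * cosh x / 3 \<le> sinh x"
proof -
  let ?g = "\<lambda>t::real. sinh t - t * cosh t / 3"
  have "?g 0 \<le> ?g x"
  proof (rule DERIV_nonneg_imp_nondecreasing[OF assms(1)])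
    fix t :: real assume t: "0 \<le> t" "t \<le> x"
    have "t * sinh t \<le> 2 * cosh t"
      using t assms sinh_less_cosh_real[of t] by (intro mult_mono) auto
    hence "cosh t - (cosh t + t * sinh t) / 3 \<ge> 0" by simp
    moreover have "(?g has_real_derivative cosh t - (cosh t + t * sinh t) / 3) (at t)"
      by (auto intro!: derivative_eq_intros)
    ultimately show "\<exists>y. (?g has_real_derivative y) (at t) \<and> 0 \<le> y" by blast
  qed
  thus ?thesis by simp
qed

text \<open>The Taylor coefficient 1/3 of \<open>x * coth x\<close> is weakened to 1/5 so that the
  bound lasts up to \<open>x = 2\<close>.\<close>

lemma coth_ge_quadratic:
  fixes x :: real
  assumes "0 \<le> x" "x \<le> 2"
  shows "(1 + x\<^sup>2 / 5) * sinh x \<le> x * cosh x"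
proof -
  let ?g = "\<lambda>t::real. t * cosh t - (1 + t\<^sup>2 / 5) * sinh t"
  have "?g 0 \<le> ?g x"
  proof (rule DERIV_nonneg_imp_nondecreasing[OF assms(1)])
    fix t :: real assume t: "0 \<le> t" "t \<le> x"
    have "t * (3 * (sinh t - t * cosh t / 3) / 5) \<ge> 0"
      using t assms mult_cosh_third_le_sinh[of t] by (intro mult_nonneg_nonneg) auto
    also have "t * (3 * (sinh t - t * cosh t / 3) / 5)
       = (cosh t + t * sinh t) - ((2 * t / 5) * sinh t + (1 + t\<^sup>2 / 5) * cosh t)"
      by (simp add: field_simps power2_eq_square)
    finally have "\<dots> \<ge> 0" .
    moreover have "(?g has_real_derivative (cosh t + t * sinh t) - ((2 * t / 5) * sinh t + (1 + t\<^sup>2 / 5) * cosh t)) (at t)"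
      by (auto intro!: derivative_eq_intros)
    ultimately show "\<exists>y. (?g has_real_derivative y) (at t) \<and> 0 \<le> y" by blast
  qed
  thus ?thesis by simp
qed

lemma ln_one_plus_le_cubic:
  fixes x :: real
  assumes "0 \<le> x"
  shows "ln (1 + x) \<le> x - x\<^sup>2 / 2 + x ^ 3 / 3"
proof -
  let ?g = "\<lambda>t::real. t - t\<^sup>2 / 2 + t ^ 3 / 3 - ln (1 + t)"
  have "?g 0 \<le> ?g x"
  proof (rule DERIV_nonneg_imp_nondecreasing[OF assms(1)])
    fix t :: real assume t: "0 \<le> t" "t \<le> x"
    have "t ^ 3 / (1 + t) \<ge> 0" using t by auto
    also have "t ^ 3 / (1 + t) = 1 - t + t\<^sup>2 - 1 / (1 + t)"
      using t by (simp add: field_simps power2_eq_square power3_eq_cube)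
    finally have "\<dots> \<ge> 0" .
    moreover have "(?g has_real_derivative 1 - t + t\<^sup>2 - 1 / (1 + t)) (at t)"
      using t by (auto intro!: derivative_eq_intros)
    ultimately show "\<exists>y. (?g has_real_derivative y) (at t) \<and> 0 \<le> y" by blast
  qed
  thus ?thesis by simp
qed

text \<open>Analytic form of the case \<open>a = 2\<close>. With \<open>h = 1 / k\<close> the left
  side is at most \<open>1 - h / 3 + 4/7 * h * x\<close>; this lies below the quadratic bound for
  \<open>x \<le> 2\<close> and below \<open>x\<close> itself for larger \<open>x\<close>.\<close>

lemma coth_ge_line:
  fixes x k :: real
  assumes "x > 0" "k \<ge> 2"
  shows "k * ln (1 + 1 / k) + (k - sqrt (k\<^sup>2 - 1)) * x \<le> x * (cosh x / sinh x)"
proof -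
  define h where "h = 1 / k"
  define e where "e = k - sqrt (k\<^sup>2 - 1)"
  have h: "0 < h" "h \<le> 1/2" "k = 1 / h" using assms by (auto simp: h_def field_simps)
  have k1: "k\<^sup>2 \<ge> 4" using power_mono[of 2 k 2] assms by simp
  \<comment> \<open>To leading order \<open>k - sqrt (k^2 - 1)\<close> is \<open>h / 2\<close>. The
    slightly larger slope 4/7 is valid for all \<open>h \<le> 1/2\<close> and still leaves room in
    both cases below.\<close>
  have "sqrt ((k - 4/7 * h)\<^sup>2) \<le> sqrt (k\<^sup>2 - 1)"
  proof (rule real_sqrt_le_mono)
    have "h * h \<le> 1/2 * (1/2)" using h by (intro mult_mono) auto
    moreover have "k * h = 1" using h by simp
    ultimately show "(k - 4/7 * h)\<^sup>2 \<le> k\<^sup>2 - 1"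
      by (simp add: power2_diff power2_eq_square algebra_simps)
  qed
  moreover have "sqrt ((k - 4/7 * h)\<^sup>2) = k - 4/7 * h" using h assms by simp
  ultimately have e: "e \<le> 4/7 * h" by (simp add: e_def)
  have kh: "k * h = 1" using h by simp
  have "k * ln (1 + 1 / k) \<le> k * (h - h\<^sup>2 / 2 + h ^ 3 / 3)"
    using ln_one_plus_le_cubic[of h] h assms unfolding h_def[symmetric] by (intro mult_left_mono) auto
  also have "\<dots> = k * h * (1 - h / 2 + h * h / 3)"
    by (simp add: algebra_simps power2_eq_square power3_eq_cube)
  also have "\<dots> = 1 - h / 2 + h * h / 3" by (simp add: kh)
  also have "\<dots> \<le> 1 - h / 3" using h(1) mult_left_mono[OF h(2), of h] by linarith
  finally have p: "k * ln (1 + 1 / k) \<le> 1 - h / 3" .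
  have ex: "e * x \<le> 4/7 * h * x" using e assms by (intro mult_right_mono) auto
  have s: "sinh x > 0" using assms by simp
  show ?thesis
  proof (cases "x \<le> 2")
    case True
    have "(1 + x\<^sup>2 / 5) \<le> x * (cosh x / sinh x)"
      using coth_ge_quadratic[of x] assms True s by (simp add: field_simps)
    moreover have "4/7 * h * x \<le> h / 3 + x\<^sup>2 / 5"
    proof -
      \<comment> \<open>Completing the square in \<open>x\<close>, where 10/7 is 5/2 times
        4/7.\<close>
      have "0 \<le> (x - 10/7 * h)\<^sup>2 / 5" by simp
      also have "\<dots> = x\<^sup>2 / 5 - 4/7 * h * x + 20/49 * (h * h)"
        by (simp add: power2_eq_square field_simps)
      also have "20/49 * (h * h) \<le> h / 3"
        using h(1) mult_left_mono[OF h(2), of h] by linarith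
      finally show ?thesis by simp
    qed
    ultimately show ?thesis using p ex unfolding e_def by linarith
  next
    case False
    have "1 \<le> cosh x / sinh x" using s sinh_less_cosh_real[of x] by simp
    hence "x * 1 \<le> x * (cosh x / sinh x)" using assms by (intro mult_left_mono) auto
    moreover have "4/7 * h * x \<le> 2/7 * x" using h assms by auto
    ultimately show ?thesis using p ex False h unfolding e_def by linarith
  qed
qed

section \<open>Hyperbolic form of powers and the lower bound for power sums\<close>

text \<open>Here \<open>exp (2 * x) = 1 + 1 / t\<close>. The value is linear in \<open>t\<close>, so
  it grows by exactly 2 when \<open>t\<close> grows by 1.\<close>

lemma coth_half_ln:
  fixes t :: real
  assumes "t > 0"
  shows "cosh (ln (1 + 1 / t) / 2) / sinh (ln (1 + 1 / t) / 2) = 2 * t + 1"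
proof -
  define x where "x = ln (1 + 1 / t) / 2"
  have e: "exp x * exp x = 1 + 1 / t"
    unfolding exp_add[symmetric] using assms by (simp add: x_def add_pos_pos)
  have x: "x > 0" using assms by (simp add: x_def add_pos_pos ln_gt_zero)
  have "cosh x / sinh x = (exp x * exp x + 1) / (exp x * exp x - 1)"
    using x by (simp add: cosh_def sinh_def exp_minus divide_simps)
  also have "\<dots> = 2 * t + 1" unfolding e using assms by (simp add: field_simps)
  finally show ?thesis by (simp add: x_def)
qed

text \<open>Holds because \<open>(t / (t + 1)) powr r = exp (- 2 * x)\<close>.\<close>

lemma inverse_one_minus_powr_eq_coth:
  fixes r t :: real
  assumes "t > 0" "r > 0"
  defines "x \<equiv> r * (ln (1 + 1 / t) / 2)"
  shows "1 / (1 - (t / (t + 1)) powr r) = (cosh x / sinh x + 1) / 2"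
proof -
  have x: "x > 0" using assms unfolding x_def by (intro mult_pos_pos divide_pos_pos ln_gt_zero) auto
  have "(t / (t + 1)) powr r = exp (r * ln (t / (t + 1)))" using assms by (simp add: powr_def)
  also have "ln (t / (t + 1)) = - ln (1 + 1 / t)"
  proof -
    have "t / (t + 1) = inverse (1 + 1 / t)" using assms by (simp add: field_simps)
    thus ?thesis using assms by (simp add: ln_inverse add_pos_pos)
  qed
  also have "r * - ln (1 + 1 / t) = - x + - x" by (simp add: x_def)
  finally have z: "(t / (t + 1)) powr r = inverse (exp x) * inverse (exp x)"
    by (simp only: exp_add exp_minus)
  have "exp x > 1" using x by simp
  moreover have "exp x * exp x > 1" using x unfolding exp_add[symmetric] by simp
  ultimately show ?thesis unfolding z cosh_def sinh_def exp_minus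
    by (simp add: divide_simps)
qed

text \<open>The Levin--Stechkin inequality.\<close>

lemma power_sum_ge:
  fixes n :: nat and r :: real
  assumes "n \<ge> 1" "r \<ge> 1"
  shows "r / (r + 1) * (real n powr r / (1 - (real n / (real n + 1)) powr r)) \<le> (\<Sum>i = 1..n. real i powr r)"
  using assms(1)
proof (induction n rule: dec_induct)
  case base
  \<comment> \<open>The base case amounts to \<open>1 + r \<le> 2 powr r\<close>, obtained from the
    tangent of \<open>ln\<close> at 1 together with \<open>ln 2 \<ge> 1/2\<close>.\<close>
  have "ln ((1 + r) / 2) \<le> (1 + r) / 2 - 1" using assms by (intro ln_le_minus_one) auto
  moreover have "ln ((1 + r) / 2) = ln (1 + r) - ln 2" using assms by (simp add: ln_div)
  moreover have "(r - 1) / 2 \<le> (r - 1) * ln 2"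
    using mult_left_mono[of "1/2" "ln 2" "r - 1"] assms ln_le_minus_one[of "1/2"] by (simp add: ln_div)
  ultimately have "ln (1 + r) \<le> r * ln 2" by (simp add: field_simps)
  hence "exp (ln (1 + r)) \<le> exp (r * ln 2)" by simp
  hence *: "1 + r \<le> 2 powr r" using assms by (simp add: powr_def)
  have "(1 / 2) powr r = 1 / 2 powr r" by (simp add: powr_divide)
  moreover have "r / (r + 1) * (1 / (1 - 1 / 2 powr r)) \<le> 1"
    using * assms by (simp add: divide_simps) (simp add: algebra_simps)
  ultimately show ?case by simp
next
  case (step n)
  define x where "x t = ln (1 + 1 / t) / 2" for t :: real
  define C where "C t = cosh (r * x t) / sinh (r * x t)" for t :: real
  define s where "s = r / (r + 1)"
  have n: "real n > 0" using step by simp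
  have xm: "0 < x (real n + 1)" "x (real n + 1) \<le> x (real n)" using n
    by (auto simp: x_def add_pos_pos frac_le)
  have "r * C (real n + 1) - cosh (x (real n + 1)) / sinh (x (real n + 1)) \<le> r * C (real n) - cosh (x (real n)) / sinh (x (real n))"
    unfolding C_def by (rule coth_scaled_diff_mono[OF assms(2) xm])
  moreover have "cosh (x (real n)) / sinh (x (real n)) = 2 * real n + 1"
    "cosh (x (real n + 1)) / sinh (x (real n + 1)) = 2 * (real n + 1) + 1"
    unfolding x_def using n by (intro coth_half_ln; simp)+
  ultimately have d: "r * (C (real n + 1) - C (real n)) \<le> 2" by (simp add: algebra_simps)
  have inv: "1 / (1 - (t / (t + 1)) powr r) = (C t + 1) / 2" if "t > 0" for t
    using inverse_one_minus_powr_eq_coth[of t r] that assms unfolding C_def x_def by simp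
  define z where "z = (real n / (real n + 1)) powr r"
  have z1: "z < 1" using n assms powr_less_mono2[of r "real n / (real n + 1)" 1] by (simp add: z_def)
  have nz: "real n powr r = z * (real n + 1) powr r"
    using n by (simp add: z_def powr_mult[symmetric])
  have zc: "z / (1 - z) = (C (real n) + 1) / 2 - 1"
    using inv[OF n] z1 unfolding z_def[symmetric] by (simp add: field_simps)
  have "s * ((real n + 1) powr r * ((C (real n + 1) + 1) / 2))
      \<le> (real n + 1) powr r * (s * ((C (real n) + 1) / 2 - 1) + 1)"
  proof -
    have "s * ((C (real n + 1) + 1) / 2) \<le> s * ((C (real n) + 1) / 2 - 1) + 1"
    proof -
      \<comment> \<open>The constant \<open>s = r / (r + 1)\<close> satisfies
        \<open>s * (2 / r) = 2 * (1 - s)\<close>, exactly what the bound \<open>d\<close> on the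
        increment of \<open>C\<close> requires.\<close>
      have "s * (C (real n + 1) - C (real n)) \<le> 2 / (r + 1)"
        using d assms by (simp add: s_def divide_right_mono)
      also have "2 / (r + 1) = 2 * (1 - s)" using assms by (simp add: s_def field_simps)
      finally have "s * C (real n + 1) - s * C (real n) \<le> 2 * (1 - s)" by (simp add: right_diff_distrib)
      moreover have eqs: "s * ((C (real n + 1) + 1) / 2) = (s * C (real n + 1) + s) / 2"
        "s * ((C (real n) + 1) / 2 - 1) = (s * C (real n) - s) / 2" by (simp_all add: field_simps)
      ultimately show ?thesis unfolding eqs by argo
    qed
    hence "(real n + 1) powr r * (s * ((C (real n + 1) + 1) / 2)) \<le> (real n + 1) powr r * (s * ((C (real n) + 1) / 2 - 1) + 1)"
      by (intro mult_left_mono) auto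
    thus ?thesis by (simp add: mult_ac)
  qed
  also have "\<dots> = s * (real n powr r / (1 - z)) + (real n + 1) powr r"
    unfolding nz zc[symmetric] by (simp add: algebra_simps)
  also have "\<dots> \<le> (\<Sum>i = 1..n. real i powr r) + (real n + 1) powr r"
    using step.IH by (simp add: s_def z_def)
  also have "\<dots> = (\<Sum>i = 1..Suc n. real i powr r)" by (simp add: add_ac)
  finally have "s * ((real n + 1) powr r * (1 / (1 - ((real n + 1) / (real n + 1 + 1)) powr r))) \<le> (\<Sum>i = 1..Suc n. real i powr r)"
    by (subst inv) auto
  thus ?case by (simp add: s_def add_ac)
qed

section \<open>Comparison of weighted sums of \<open>x powr a\<close>\<close>

lemma convex_powr_chord:
  fixes a v m t :: real
  assumes "a \<ge> 1" "0 < v" "0 < m" "0 \<le> t" "t \<le> 1"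
  shows "((1 - t) * v + t * m) powr a \<le> (1 - t) * v powr a + t * m powr a"
proof -
  have "convex_on {0<..} (\<lambda>x::real. x powr a)"
  proof (rule f''_ge0_imp_convex)
    show "((\<lambda>x. x powr a) has_real_derivative a * x powr (a - 1)) (at x)" if "x \<in> {0<..}" for x
      using that by (auto intro!: derivative_eq_intros)
    show "((\<lambda>x. a * x powr (a - 1)) has_real_derivative a * ((a - 1) * x powr (a - 2))) (at x)" if "x \<in> {0<..}" for x
      using that by (auto intro!: derivative_eq_intros)
  qed (use assms in auto)
  from convex_onD[OF this, of t v m] assms show ?thesis by simp
qed

text \<open>The error \<open>D\<close> vanishes at \<open>v\<close>, \<open>q\<close> and
  \<open>m\<close>, so its derivative vanishes at some \<open>y < z\<close> and its second
  derivative at some \<open>w\<close> between them. As \<open>x powr (a - 2)\<close> is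
  nondecreasing, \<open>D2 \<le> 0\<close> left of \<open>w\<close>, hence \<open>D1 \<ge> 0\<close>
  left of \<open>y\<close>, hence \<open>D p \<le> D v = 0\<close>.\<close>

lemma powr_le_quadratic_interpolation:
  fixes a p v q m :: real
  assumes "a \<ge> 2" "0 < p" "p \<le> v" "v < q" "q < m"
  obtains A B C where "C \<ge> 0" "A + B * v + C * v\<^sup>2 = v powr a" "A + B * q + C * q\<^sup>2 = q powr a"
    "A + B * m + C * m\<^sup>2 = m powr a" "p powr a \<le> A + B * p + C * p\<^sup>2"
proof -
  \<comment> \<open>Newton's divided differences at \<open>v\<close>, \<open>q\<close>,
    \<open>m\<close>, expanded into monomial coefficients.\<close>
  define E where "E = (q powr a - v powr a) / (q - v)"
  define C where "C = ((m powr a - v powr a) / (m - v) - E) / (m - q)"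
  define B where "B = E - C * (v + q)"
  define A where "A = v powr a - E * v + C * v * q"
  have e: "E * (q - v) = q powr a - v powr a" using assms by (simp add: E_def)
  have c: "(C * (m - q) + E) * (m - v) = m powr a - v powr a" using assms by (simp add: C_def)
  have v: "A + B * v + C * v\<^sup>2 = v powr a"
    by (simp add: A_def B_def power2_eq_square algebra_simps)
  have q: "A + B * q + C * q\<^sup>2 = q powr a"
    using e by (simp add: A_def B_def power2_eq_square algebra_simps)
  have m: "A + B * m + C * m\<^sup>2 = m powr a"
    using c by (simp add: A_def B_def power2_eq_square algebra_simps)
  define D D1 D2 where "D x = x powr a - (A + B * x + C * x\<^sup>2)"
    and "D1 x = a * x powr (a - 1) - (B + 2 * C * x)"
    and "D2 x = a * ((a - 1) * x powr (a - 2)) - 2 * C" for x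
  have D: "(D has_real_derivative D1 x) (at x)" if "x > 0" for x
    unfolding D_def[abs_def] D1_def using that by (auto intro!: derivative_eq_intros)
  have D1: "(D1 has_real_derivative D2 x) (at x)" if "x > 0" for x
    unfolding D1_def[abs_def] D2_def using that by (auto intro!: derivative_eq_intros)
  obtain y where y: "v < y" "y < q" "D q - D v = (q - v) * D1 y"
    using MVT2[of v q D D1] D assms by auto
  obtain z where z: "q < z" "z < m" "D m - D q = (m - q) * D1 z"
    using MVT2[of q m D D1] D assms by auto
  have yz0: "D1 y = 0" "D1 z = 0" using y z v q m assms by (auto simp: D_def)
  obtain w where w: "y < w" "w < z" "D1 z - D1 y = (z - y) * D2 w"
    using MVT2[of y z D1 D2] D1 assms y z by auto
  have w0: "D2 w = 0" using w yz0 by simp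
  have "0 \<le> a * ((a - 1) * w powr (a - 2))" using assms by (intro mult_nonneg_nonneg) auto
  hence "C \<ge> 0" using w0 by (simp add: D2_def)
  have D2: "D2 x \<le> 0" if "0 < x" "x \<le> w" for x
  proof -
    have "x powr (a - 2) \<le> w powr (a - 2)" using that assms by (intro powr_mono2) auto
    hence "a * ((a - 1) * x powr (a - 2)) \<le> a * ((a - 1) * w powr (a - 2))"
      using assms by (intro mult_left_mono) auto
    thus ?thesis using w0 by (simp add: D2_def)
  qed
  have D1nonneg: "0 \<le> D1 x" if "0 < x" "x \<le> y" for x
  proof -
    have "D1 y \<le> D1 x"
    proof (rule DERIV_nonpos_imp_nonincreasing[OF that(2)])
      fix u assume "x \<le> u" "u \<le> y"
      thus "\<exists>l. (D1 has_real_derivative l) (at u) \<and> l \<le> 0"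
        using D1[of u] D2[of u] that w by (intro exI[of _ "D2 u"]) auto
    qed
    thus ?thesis using yz0 by simp
  qed
  have "D p \<le> D v"
  proof (rule DERIV_nonneg_imp_nondecreasing[OF assms(3)])
    fix u assume "p \<le> u" "u \<le> v"
    thus "\<exists>l. (D has_real_derivative l) (at u) \<and> 0 \<le> l"
      using D[of u] D1nonneg[of u] assms y by (intro exI[of _ "D1 u"]) auto
  qed
  hence "p powr a \<le> A + B * p + C * p\<^sup>2" using v by (simp add: D_def)
  with \<open>C \<ge> 0\<close> v q m show ?thesis using that by blast
qed

text \<open>Both sides have total weight \<open>2 * k\<close> and equal first moments, so for a
  quadratic only the leading coefficient matters, and \<open>sq\<close> settles that. If
  \<open>p \<le> v\<close>, the interpolating quadratic can only enlarge the left side, at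
  \<open>p\<close>, and agrees with \<open>x powr a\<close> at the other three points.\<close>

lemma powr_sum_le_of_square_sum_le:
  fixes a k m p q v :: real
  assumes "a \<ge> 2" "k \<ge> 1" "0 < p" "p \<le> m" "0 < v" "v < q" "q < m"
    and sum: "(k - 1) * p + (k + 1) * q = k * m + k * v"
    and sq: "(k - 1) * p\<^sup>2 + (k + 1) * q\<^sup>2 \<le> k * m\<^sup>2 + k * v\<^sup>2"
  shows "(k - 1) * p powr a + (k + 1) * q powr a \<le> k * m powr a + k * v powr a"
proof (cases "p \<le> v")
  case True
  obtain A B C where abc: "C \<ge> 0" "A + B * v + C * v\<^sup>2 = v powr a" "A + B * q + C * q\<^sup>2 = q powr a"
    "A + B * m + C * m\<^sup>2 = m powr a" "p powr a \<le> A + B * p + C * p\<^sup>2"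
    by (rule powr_le_quadratic_interpolation[OF assms(1,3) True assms(6,7)])
  have "(k - 1) * p powr a + (k + 1) * q powr a
      \<le> (k - 1) * (A + B * p + C * p\<^sup>2) + (k + 1) * (A + B * q + C * q\<^sup>2)"
    using abc(5) abc(3)[symmetric] assms by (intro add_mono mult_left_mono) auto
  also have "\<dots> = 2 * k * A + B * ((k - 1) * p + (k + 1) * q) + C * ((k - 1) * p\<^sup>2 + (k + 1) * q\<^sup>2)"
    by (simp add: algebra_simps)
  also have "\<dots> \<le> 2 * k * A + B * (k * m + k * v) + C * (k * m\<^sup>2 + k * v\<^sup>2)"
    unfolding sum by (intro add_left_mono mult_left_mono sq abc(1))
  also have "\<dots> = k * (A + B * m + C * m\<^sup>2) + k * (A + B * v + C * v\<^sup>2)"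
    by (simp add: algebra_simps)
  finally show ?thesis unfolding abc .
next
  case False
  \<comment> \<open>Now \<open>p\<close> and \<open>q\<close> both lie in the interval from
    \<open>v\<close> to \<open>m\<close>; in these coordinates \<open>sum\<close> reads
    \<open>(k - 1) * s + (k + 1) * t = k\<close>, so the chord bounds add up to the right
    side.\<close>
  define s t where "s = (p - v) / (m - v)" and "t = (q - v) / (m - v)"
  have st: "s * (m - v) = p - v" "t * (m - v) = q - v" using assms by (auto simp: s_def t_def)
  have b: "0 \<le> s" "s \<le> 1" "0 \<le> t" "t \<le> 1" using assms False by (auto simp: s_def t_def)
  have pq: "p = (1 - s) * v + s * m" "q = (1 - t) * v + t * m" using st by (auto simp: algebra_simps)
  have "((k - 1) * s + (k + 1) * t) * (m - v) = (k - 1) * (s * (m - v)) + (k + 1) * (t * (m - v))"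
    by (simp add: algebra_simps)
  also have "\<dots> = k * (m - v)" unfolding st using sum by (simp add: algebra_simps)
  finally have w: "(k - 1) * s + (k + 1) * t = k" using assms by simp
  have "p powr a \<le> (1 - s) * v powr a + s * m powr a" "q powr a \<le> (1 - t) * v powr a + t * m powr a"
    using convex_powr_chord[of a v m s] convex_powr_chord[of a v m t] assms(1,3-5) b
    unfolding pq[symmetric] by simp_all
  hence "(k - 1) * p powr a + (k + 1) * q powr a
      \<le> (k - 1) * ((1 - s) * v powr a + s * m powr a) + (k + 1) * ((1 - t) * v powr a + t * m powr a)"
    using assms by (intro add_mono mult_left_mono) auto
  also have "\<dots> = (2 * k - ((k - 1) * s + (k + 1) * t)) * v powr a + ((k - 1) * s + (k + 1) * t) * m powr a"
    by (simp add: algebra_simps)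
  finally show ?thesis unfolding w by simp
qed

text \<open>In terms of \<open>a = m * (1 - z)\<close> and \<open>b = 1 - m\<close> the claim is
  \<open>2 * b^2 \<le> (k - 1) * (a^2 + 2 * a * b)\<close>. For \<open>a > 0\<close> and
  \<open>b \<ge> 0\<close> this means that \<open>b / a\<close> is at most the positive root
  \<open>(k - 1 + sqrt (k^2 - 1)) / 2\<close>, which is \<open>bound\<close>.\<close>

lemma square_sum_le:
  fixes k m z p q :: real
  assumes "k > 1" "0 < m" "m \<le> 1" "z < 1"
    and bound: "1 / m - 1 \<le> (1 - z) * (k - 1 + sqrt (k\<^sup>2 - 1)) / 2"
    and p: "(k - 1) * p = k * m - 1" and q: "(k + 1) * q = k * m * z + 1"
  shows "(k - 1) * p\<^sup>2 + (k + 1) * q\<^sup>2 \<le> k * m\<^sup>2 + k * (m * z)\<^sup>2"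
proof -
  define w where "w = sqrt (k\<^sup>2 - 1)"
  have "k\<^sup>2 > 1" using assms by (simp add: one_less_power)
  hence w2: "w\<^sup>2 = k\<^sup>2 - 1" by (simp add: w_def)
  have "sqrt ((k - 1)\<^sup>2) \<le> w" unfolding w_def
    using assms by (intro real_sqrt_le_mono) (simp add: power2_eq_square algebra_simps)
  hence w1: "k - 1 \<le> w" using assms by simp
  \<comment> \<open>The two sides differ by a quadratic form in \<open>a\<close> and \<open>b\<close> that splits into linear factors.\<close>
  define a b where "a = m * (1 - z)" and "b = 1 - m"
  have ab: "a \<ge> 0" "b \<ge> 0" using assms by (auto simp: a_def b_def)
  have "m * (1 / m - 1) \<le> m * ((1 - z) * (k - 1 + w) / 2)"
    using bound assms unfolding w_def by (intro mult_left_mono) auto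
  hence "b \<le> a * (k - 1 + w) / 2" using assms by (simp add: a_def b_def algebra_simps)
  hence "(a * (k - 1 + w) - 2 * b) * (2 * b + a * (w - (k - 1))) \<ge> 0"
    using ab w1 by (intro mult_nonneg_nonneg add_nonneg_nonneg) auto
  also have "(a * (k - 1 + w) - 2 * b) * (2 * b + a * (w - (k - 1)))
      = a\<^sup>2 * (w\<^sup>2 - (k - 1)\<^sup>2) + 4 * a * b * (k - 1) - 4 * b\<^sup>2"
    by (simp add: power2_eq_square algebra_simps)
  also have "\<dots> = 2 * ((k - 1) * (a\<^sup>2 + 2 * a * b) - 2 * b\<^sup>2)"
    unfolding w2 by (simp add: power2_eq_square algebra_simps)
  finally have key: "(k - 1) * (a\<^sup>2 + 2 * a * b) - 2 * b\<^sup>2 \<ge> 0" by simp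
  \<comment> \<open>The factor \<open>k^2 - 1\<close> leaves only the products
    \<open>(k - 1) * p\<close> and \<open>(k + 1) * q\<close>, which the hypotheses give without
    division.\<close>
  have "(k\<^sup>2 - 1) * ((k - 1) * p\<^sup>2 + (k + 1) * q\<^sup>2) = (k + 1) * ((k - 1) * p)\<^sup>2 + (k - 1) * ((k + 1) * q)\<^sup>2"
    by (simp add: power2_eq_square algebra_simps)
  also have "\<dots> = (k\<^sup>2 - 1) * (k * m\<^sup>2 + k * (m * z)\<^sup>2) - k * ((k - 1) * (a\<^sup>2 + 2 * a * b) - 2 * b\<^sup>2)"
    unfolding p q a_def b_def by (simp add: power2_eq_square algebra_simps)
  also have "\<dots> \<le> (k\<^sup>2 - 1) * (k * m\<^sup>2 + k * (m * z)\<^sup>2)"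
    using key assms by simp
  finally show ?thesis using \<open>k\<^sup>2 > 1\<close> by simp
qed

section \<open>Means of powers and their differences\<close>

definition avg_powr :: "real \<Rightarrow> nat \<Rightarrow> real" where
  "avg_powr r n = (1 / real n) * (\<Sum>i = 1..n. real i powr r)"

lemma avg_powr_pos: "n \<ge> 1 \<Longrightarrow> avg_powr r n > 0"
  unfolding avg_powr_def by (intro mult_pos_pos sum_pos) auto

lemma avg_powr_Suc: "real (Suc n) * avg_powr r (Suc n) = real n * avg_powr r n + real (Suc n) powr r"
  unfolding avg_powr_def by (cases "n = 0") (simp_all del: of_nat_Suc)

lemma avg_powr_le:
  assumes "n \<ge> 1" "r \<ge> 0"
  shows "avg_powr r n \<le> real n powr r"
proof -
  have "(\<Sum>i = 1..n. real i powr r) \<le> of_nat (card {1..n}) * real n powr r"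
    using assms by (intro sum_bounded_above powr_mono2) auto
  thus ?thesis using assms by (simp add: avg_powr_def field_simps)
qed

text \<open>Reciprocal form of \<open>power_sum_ge\<close>, bounding \<open>1 / m\<close> for the
  scaled mean \<open>m\<close>.\<close>

lemma inverse_avg_powr_le:
  fixes n :: nat and r :: real
  assumes "n \<ge> 1" "r \<ge> 1"
  shows "real n powr r / avg_powr r n \<le> real n * (1 - (real n / (real n + 1)) powr r) * (1 + 1 / r)"
proof -
  define S where "S = (\<Sum>i = 1..n. real i powr r)"
  define d where "d = 1 - (real n / (real n + 1)) powr r"
  have d: "d > 0" using assms powr_less_mono2[of r "real n / (real n + 1)" 1] by (simp add: d_def)
  have S: "S > 0" unfolding S_def using assms by (intro sum_pos) auto
  have dr: "d * (1 + 1 / r) > 0" using d assms by (intro mult_pos_pos) (auto simp: add_pos_pos)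
  have "r / (r + 1) * (real n powr r / d) \<le> S"
    using power_sum_ge[OF assms] by (simp add: S_def d_def)
  also have "r / (r + 1) * (real n powr r / d) = real n powr r / (d * (1 + 1 / r))"
    using d assms by (simp add: divide_simps)
  finally have "real n powr r \<le> S * (d * (1 + 1 / r))"
    using dr by (simp only: pos_divide_le_eq)
  hence "real n powr r / S \<le> d * (1 + 1 / r)" using S by (simp add: pos_divide_le_eq mult.commute)
  hence "real n * (real n powr r / S) \<le> real n * (d * (1 + 1 / r))" by (intro mult_left_mono) auto
  thus ?thesis unfolding avg_powr_def S_def[symmetric] d_def[symmetric] using assms S by (simp add: mult_ac)
qed

text \<open>Provides the hypothesis \<open>bound\<close> of \<open>square_sum_le\<close>. After
  \<open>inverse_avg_powr_le\<close>, dividing by \<open>d\<close> and using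
  \<open>1 / d = (C + 1) / 2\<close> leaves \<open>2 * n / r + n - w \<le> C\<close>, which is
  \<open>coth_ge_line\<close> at \<open>X\<close> divided by \<open>X\<close>.\<close>

lemma avg_powr_sqrt_bound:
  fixes n :: nat and r :: real
  assumes "n \<ge> 2" "r \<ge> 1"
  shows "real n powr r / avg_powr r n - 1
    \<le> (1 - (real n / (real n + 1)) powr r) * (real n - 1 + sqrt ((real n)\<^sup>2 - 1)) / 2"
proof -
  define d where "d = 1 - (real n / (real n + 1)) powr r"
  define w where "w = sqrt ((real n)\<^sup>2 - 1)"
  define X where "X = r * (ln (1 + 1 / real n) / 2)"
  define C where "C = cosh X / sinh X"
  have d: "d > 0" using assms powr_less_mono2[of r "real n / (real n + 1)" 1] by (simp add: d_def)
  have X: "X > 0" using assms unfolding X_def by (intro mult_pos_pos divide_pos_pos ln_gt_zero) auto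
  have "1 / d = (C + 1) / 2"
    using inverse_one_minus_powr_eq_coth[of "real n" r] assms by (simp add: d_def C_def X_def)
  hence dC: "d * ((C + 1) / 2) = 1" using d by (simp add: field_simps)
  have "real n * ln (1 + 1 / real n) + (real n - w) * X \<le> X * C"
    using coth_ge_line[OF X, of "real n"] assms by (simp add: w_def C_def)
  moreover have "real n * ln (1 + 1 / real n) = X * (2 * real n / r)" using assms by (simp add: X_def)
  ultimately have "X * (2 * real n / r + (real n - w)) \<le> X * C" by (simp add: algebra_simps)
  hence "2 * real n / r + (real n - w) \<le> C" using X by simp
  moreover have "real n * (1 + 1 / r) = real n + 2 * real n / r / 2" by (simp add: distrib_left)
  ultimately have "real n * (1 + 1 / r) - (C + 1) / 2 \<le> (real n - 1 + w) / 2" by argo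
  hence "d * (real n * (1 + 1 / r) - (C + 1) / 2) \<le> d * ((real n - 1 + w) / 2)"
    using d by (intro mult_left_mono) auto
  moreover have "d * (real n * (1 + 1 / r) - (C + 1) / 2) = real n * d * (1 + 1 / r) - 1"
    using dC by (simp add: right_diff_distrib mult_ac)
  moreover have "real n powr r / avg_powr r n \<le> real n * d * (1 + 1 / r)"
    using inverse_avg_powr_le[of n r] assms by (simp add: d_def)
  ultimately show ?thesis unfolding d_def[symmetric] w_def[symmetric] by (simp add: mult_ac) argo
qed

text \<open>The four scaled means are the points \<open>q\<close>, \<open>v = m * z\<close>,
  \<open>m\<close> and \<open>p\<close> of \<open>powr_sum_le_of_square_sum_le\<close>. The
  recursion for the means gives \<open>(k - 1) * p = k * m - 1\<close> and
  \<open>(k + 1) * q = k * v + 1\<close>, hence equal sums; the order of the points and the bound on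
  squares remain.\<close>

lemma avg_powr_second_difference:
  fixes n :: nat and r a :: real
  assumes "n \<ge> 1" "r \<ge> 1" "a \<ge> 2"
  shows "real (Suc n) * (avg_powr r (Suc n) / real (Suc n) powr r) powr a
       - real n * (avg_powr r n / real (Suc n) powr r) powr a
    \<le> real n * (avg_powr r n / real n powr r) powr a
       - real (n - 1) * (avg_powr r (n - 1) / real n powr r) powr a"
proof -
  define k where "k = real n"
  define z where "z = (k / (k + 1)) powr r"
  define m where "m = avg_powr r n / k powr r"
  define q where "q = avg_powr r (Suc n) / (k + 1) powr r"
  have k: "k \<ge> 1" using assms by (simp add: k_def)
  have z: "0 < z" "z < 1" using k assms powr_less_mono2[of r "k / (k + 1)" 1] by (auto simp: z_def)
  have m: "0 < m" "m \<le> 1" using avg_powr_pos[of n r] avg_powr_le[of n r] assms k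
    by (auto simp: m_def k_def)
  have z': "z = k powr r / (k + 1) powr r" using k by (simp add: z_def powr_divide)
  have v: "avg_powr r n / (k + 1) powr r = m * z" using k by (simp add: m_def z')
  have "(k + 1) * avg_powr r (Suc n) = k * avg_powr r n + (k + 1) powr r"
    using avg_powr_Suc[of n r] by (simp add: k_def add_ac)
  hence "(k + 1) * q = (k * avg_powr r n + (k + 1) powr r) / (k + 1) powr r" by (simp add: q_def)
  also have "\<dots> = k * (avg_powr r n / (k + 1) powr r) + 1" using k by (simp add: add_divide_distrib)
  finally have q: "(k + 1) * q = k * m * z + 1" unfolding v by simp
  have "m * z \<le> 1 * z" using m z by (intro mult_right_mono) auto
  hence mz: "0 < m * z" "m * z < 1" using mult_pos_pos[OF m(1) z(1)] z by linarith+
  have "(k + 1) * (m * z) < (k + 1) * q" unfolding q using mz by (simp add: algebra_simps)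
  hence vq: "m * z < q" using k by simp
  \<comment> \<open>By the recursion, \<open>q < m\<close> is equivalent to
    \<open>1 / m < k * (1 - z) + 1\<close>. Since
    \<open>1 / m \<le> k * (1 - z) * (1 + 1 / r)\<close>, the present estimate suffices.\<close>
  have "k * (1 - z) < r"
  proof -
    have "ln (1 + 1 / k) < 1 / k" using k by (intro ln_add_one_self_less_self) auto
    hence "r * ln (1 + 1 / k) < r * (1 / k)" using assms by (intro mult_strict_left_mono) auto
    hence "- (r / k) < r * (- ln (1 + 1 / k))" by simp
    moreover have "- ln (1 + 1 / k) = ln (k / (k + 1))"
    proof -
      have "k / (k + 1) = inverse (1 + 1 / k)" using k by (simp add: field_simps)
      thus ?thesis using k by (simp add: ln_inverse add_pos_pos)
    qed
    ultimately have "exp (- (r / k)) < z" using k by (simp add: z_def powr_def)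
    moreover have "1 + (- (r / k)) \<le> exp (- (r / k))" by (rule exp_ge_add_one_self)
    ultimately have "1 - z < r / k" by simp
    thus ?thesis using k by (simp add: field_simps)
  qed
  hence "k * (1 - z) / r < 1" using assms by simp
  hence "k * (1 - z) * (1 + 1 / r) < k * (1 - z) + 1" by (simp add: distrib_left)
  hence "1 / m < k * (1 - z) + 1"
    using inverse_avg_powr_le[of n r] assms by (simp add: m_def z_def k_def)
  hence "(k + 1) * q < (k + 1) * m" unfolding q using m by (simp add: field_simps)
  hence qm: "q < m" using k by simp
  have "(k + 1) * q powr a - k * (m * z) powr a
      \<le> k * m powr a - real (n - 1) * (avg_powr r (n - 1) / k powr r) powr a"
  proof (cases "n = 1")
    case True
    hence k1: "k = 1" by (simp add: k_def)
    \<comment> \<open>The weight \<open>k - 1\<close> vanishes, so any admissible value serves as \<open>p\<close>.\<close>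
    have m1: "m = 1" using k1 True by (simp add: m_def avg_powr_def)
    have q1: "q = (1 + z) / 2" using q k1 m1 by simp
    \<comment> \<open>\<open>square_sum_le\<close> requires \<open>k > 1\<close>; here the bound on
      squares is just \<open>(1 - z)^2 \<ge> 0\<close>.\<close>
    have sq: "2 * q\<^sup>2 \<le> 1 + z\<^sup>2" unfolding q1
      using zero_le_power2[of "1 - z"] by (simp add: power2_eq_square field_simps)
    have "(k - 1) * m powr a + (k + 1) * q powr a \<le> k * m powr a + k * (m * z) powr a"
      by (rule powr_sum_le_of_square_sum_le[OF assms(3) k m(1) order_refl mz(1) vq qm])
        (use sq q k1 m1 in simp_all)
    thus ?thesis using True k1 by simp
  next
    case False
    hence n2: "n \<ge> 2" using assms by simp
    define p where "p = avg_powr r (n - 1) / k powr r"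
    have kn: "real (n - 1) = k - 1" using n2 by (simp add: k_def)
    have "k * avg_powr r n = (k - 1) * avg_powr r (n - 1) + k powr r"
      using avg_powr_Suc[of "n - 1" r] n2 kn by (simp add: k_def del: of_nat_Suc)
    hence "k * m = ((k - 1) * avg_powr r (n - 1) + k powr r) / k powr r" by (simp add: m_def)
    also have "\<dots> = (k - 1) * p + 1" using k by (simp add: p_def add_divide_distrib)
    finally have p: "(k - 1) * p = k * m - 1" by simp
    have p0: "p > 0" using avg_powr_pos[of "n - 1" r] n2 k by (simp add: p_def)
    have k1: "k > 1" using n2 by (simp add: k_def)
    have "(k - 1) * p \<le> (k - 1) * m" unfolding p using m by (simp add: algebra_simps)
    hence pm: "p \<le> m" using k1 by simp
    have "1 / m - 1 \<le> (1 - z) * (k - 1 + sqrt (k\<^sup>2 - 1)) / 2"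
      using avg_powr_sqrt_bound[OF n2 assms(2)] by (simp add: m_def z_def k_def)
    note sq = square_sum_le[OF k1 m z(2) this p q]
    have "(k - 1) * p powr a + (k + 1) * q powr a \<le> k * m powr a + k * (m * z) powr a"
      by (rule powr_sum_le_of_square_sum_le[OF assms(3) k p0 pm mz(1) vq qm _ sq]) (simp add: p q)
    thus ?thesis unfolding kn p_def by simp
  qed
  thus ?thesis using v by (simp add: m_def q_def k_def add_ac)
qed

text \<open>States that \<open>S n / b n\<close> does not decrease from \<open>n\<close> to
  \<open>Suc n\<close>, cleared of denominators. The quotients \<open>F\<close> of increments
  decrease, so the latest one is at most the overall quotient \<open>b n / S n\<close>.\<close>

lemma avg_powr_ratio_le:
  fixes n :: nat and r a :: real
  assumes "n \<ge> 1" "r \<ge> 1" "a \<ge> 2"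
  shows "avg_powr (r * a) n * avg_powr r (Suc n) powr a \<le> avg_powr (r * a) (Suc n) * avg_powr r n powr a"
proof -
  define b where "b k = real k * avg_powr r k powr a" for k
  define s where "s k = real k powr (r * a)" for k :: nat
  define S where "S k = (\<Sum>i = 1..k. s i)" for k :: nat
  \<comment> \<open>The index is shifted: \<open>F k\<close> belongs to the increment from
    \<open>k\<close> to \<open>Suc k\<close>, so the sequence starts at \<open>F 0\<close> with
    \<open>b 0 = 0\<close>.\<close>
  define F where "F k = (b (Suc k) - b k) / s (Suc k)" for k
  have pos: "avg_powr r k \<ge> 0" for k unfolding avg_powr_def by (intro mult_nonneg_nonneg sum_nonneg) auto
  have sc: "(avg_powr r k / real j powr r) powr a = avg_powr r k powr a / s j" if "j \<ge> 1" for j k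
    using that pos by (simp add: powr_divide powr_powr s_def)
  have F: "F (Suc k) \<le> F k" for k
    using avg_powr_second_difference[of "Suc k" r a] assms sc[of "Suc k"] sc[of "Suc (Suc k)"]
    by (simp add: F_def b_def diff_divide_distrib del: of_nat_Suc)
  have bS: "b (Suc k) = b k + F k * s (Suc k)" for k
    by (simp add: F_def s_def)
  have S0: "S k \<ge> 0" for k unfolding S_def s_def by (intro sum_nonneg) auto
  have SS: "S (Suc k) = S k + s (Suc k)" for k by (simp add: S_def)
  have bge: "F k * S k \<le> b k" for k
  proof (induction k)
    case 0
    show ?case by (simp add: S_def b_def)
  next
    case (Suc k)
    have "F (Suc k) * S (Suc k) \<le> F k * S (Suc k)" using F S0 by (intro mult_right_mono)
    also have "\<dots> \<le> b (Suc k)" using Suc by (simp add: SS bS algebra_simps)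
    finally show ?case .
  qed
  have "S n * b (Suc n) = S n * b n + s (Suc n) * (F n * S n)" by (simp add: bS algebra_simps)
  also have "\<dots> \<le> S n * b n + s (Suc n) * b n"
    using bge by (intro add_left_mono mult_left_mono) (auto simp: s_def)
  also have "\<dots> = S (Suc n) * b n" by (simp add: SS algebra_simps)
  finally have "S n * b (Suc n) \<le> S (Suc n) * b n" .
  moreover have "S k = real k * avg_powr (r * a) k" if "k \<ge> 1" for k
    using that by (simp add: avg_powr_def S_def s_def)
  ultimately have "(real n * real (Suc n)) * (avg_powr (r * a) n * avg_powr r (Suc n) powr a)
      \<le> (real n * real (Suc n)) * (avg_powr (r * a) (Suc n) * avg_powr r n powr a)"
    using assms by (simp add: b_def mult_ac del: of_nat_Suc)
  moreover have "real n * real (Suc n) > 0" using assms by simp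
  ultimately show ?thesis by (simp only: mult_le_cancel_left_pos)
qed

theorem corollary1p1:
  fixes n :: nat and r r' :: real
  assumes "n \<ge> 1" and "r \<ge> 1" and "r' \<ge> 2 * r + 1"
  shows "P n r \<ge> P n r'"
proof -
  define a where "a = r' / r"
  have a: "a \<ge> 2" "r * a = r'" using assms by (auto simp: a_def field_simps)
  have P: "P n t = (avg_powr t n / avg_powr t (Suc n)) powr (1 / t)" for t
    by (simp add: P_def avg_powr_def)
  have pos: "avg_powr t n > 0" "avg_powr t (Suc n) > 0" for t
    using assms avg_powr_pos[of n t] avg_powr_pos[of "Suc n" t] by auto
  have "avg_powr r' n / avg_powr r' (Suc n) \<le> avg_powr r n powr a / avg_powr r (Suc n) powr a"
    using avg_powr_ratio_le[OF assms(1,2) a(1)] pos[of r] pos[of r'] unfolding a(2)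
    by (simp add: divide_simps mult_ac)
  also have "\<dots> = (avg_powr r n / avg_powr r (Suc n)) powr a" using pos[of r] by (simp add: powr_divide)
  \<comment> \<open>The exponents then combine to \<open>a / r' = 1 / r\<close>.\<close>
  finally have "P n r' \<le> ((avg_powr r n / avg_powr r (Suc n)) powr a) powr (1 / r')"
    unfolding P using pos[of r'] assms by (intro powr_mono2) (auto simp: less_imp_le)
  also have "\<dots> = P n r" unfolding P using assms by (simp add: powr_powr a_def)
  finally show ?thesis .
qed

end
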